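(* Let $\mathfrak{g}$ be a finite-dimensional real unimodular Lie algebra with an abelian complex structure $J$. If $(\mathfrak{g},J)$ admits a pluriclosed inner product, then $\mathfrak{g}$ is $2$-step nilpotent.
   Context: A complex structure on a finite-dimensional real Lie algebra $\mathfrak g$ is an endomorphism $J$ of $\mathfrak g$ with $J^2=-\mathrm{Id}$ and $J[x,y]-[Jx,y]-[x,Jy]-J[Jx,Jy]=0$ for all $x,y\in\mathfrak g$. It is called abelian if $[Jx,Jy]=[x,y]$ for all $x,y\in\mathfrak g$. $\mathfrak g$ is unimodular if $\mathrm{tr}(\mathrm{ad}_x)=0$ for every $x\in\mathfrak g$. A Hermitian inner product on $(\mathfrak g,J)$ is a positive definite inner product $g$ on $\mathfrak g$ with $g(Jx,Jy)=g(x,y)$ for all $x,y$; its fundamental form is $\omega(x,y)=g(Jx,y)$. It is pluriclosed if $dJd\omega=0$, where $d$ is the Chevalley--Eilenberg differential on $\Lambda^*\mathfrak g^*$ (e.g. $d\alpha(x,y)=-\alpha([x,y])$ for $\alpha \in \mathfrak g^*$) and $J$ acts on a $3$-form $\alpha$ by $(J\alpha)(x,y,z)=\alpha(Jx,Jy,Jz)$ (up to an overall sign, which is irrelevant here). A pluriclosed inner product on $(\mathfrak g,J)$ means a Hermitian inner product that is pluriclosed. "$2$-step nilpotent" means $[[\mathfrak g,\mathfrak g],\mathfrak g]=0$ (abelian Lie algebras are included). *)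

theory Defs
  imports "HOL-Analysis.Analysis"
begin

definition finite_dim :: "'a::real_vector itself \<Rightarrow> bool" where
  "finite_dim _ \<longleftrightarrow> (\<exists>B::'a set. finite B \<and> span B = UNIV)"

text \<open>Meaningful when the space is finite-dimensional and the map is linear; the value then does
  not depend on the basis, see \<open>lin_trace_eq\<close>.\<close>

definition lin_trace :: "('a::real_vector \<Rightarrow> 'a) \<Rightarrow> real" where
  "lin_trace f =
    (let B = (SOME B. independent B \<and> span B = UNIV) in \<Sum>b\<in>B. representation B (f b) b)"

lemma finite_dim_finite_basis:
  fixes B :: "'a::real_vector set"
  assumes "finite_dim TYPE('a)" "independent B"
  shows "finite B"
proof -
  obtain C :: "'a set" where "finite C" "span C = UNIV"
    using assms(1) unfolding finite_dim_def by blast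
  then show ?thesis
    using real_vector.independent_span_bound[of C B] assms(2) by auto
qed

lemma lin_trace_eq:
  fixes f :: "'a::real_vector \<Rightarrow> 'a"
  assumes fd: "finite_dim TYPE('a)" and f: "linear f"
    and C: "independent C" "span C = UNIV"
  shows "lin_trace f = (\<Sum>c\<in>C. representation C (f c) c)"
proof -
  define B where "B = (SOME B :: 'a set. independent B \<and> span B = UNIV)"
  have "independent B \<and> span B = UNIV"
    unfolding B_def by (rule someI[where P = "\<lambda>B. independent B \<and> span B = UNIV"]) (use C in simp)
  then have B: "independent B" "span B = UNIV" by auto
  have fin: "finite B" "finite C"
    using finite_dim_finite_basis[OF fd] B C by auto
  have eB: "(\<Sum>b\<in>B. representation B v b *\<^sub>R b) = v" for v
    using real_vector.sum_representation_eq[OF B(1) _ fin(1), of v] B(2) by auto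
  have eC: "(\<Sum>c\<in>C. representation C v c *\<^sub>R c) = v" for v
    using real_vector.sum_representation_eq[OF C(1) _ fin(2), of v] C(2) by auto
  have "lin_trace f = (\<Sum>b\<in>B. representation B (f b) b)"
    unfolding lin_trace_def B_def by (simp add: Let_def)
  also have "\<dots> = (\<Sum>b\<in>B. \<Sum>c\<in>C. representation C (f b) c * representation B c b)"
  proof (rule sum.cong[OF refl])
    fix b
    have "representation B (f b) b = representation B (\<Sum>c\<in>C. representation C (f b) c *\<^sub>R c) b"
      by (simp only: eC)
    also have "\<dots> = (\<Sum>c\<in>C. representation C (f b) c * representation B c b)"
      using B by (simp add: real_vector.representation_sum real_vector.representation_scale)
    finally show "representation B (f b) b = \<dots>" .
  qed
  also have "\<dots> = (\<Sum>c\<in>C. \<Sum>b\<in>B. representation C (f b) c * representation B c b)"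
    by (rule sum.swap)
  also have "\<dots> = (\<Sum>c\<in>C. representation C (f c) c)"
  proof (rule sum.cong[OF refl])
    fix c
    have "representation C (f c) c = representation C (f (\<Sum>b\<in>B. representation B c b *\<^sub>R b)) c"
      by (simp only: eB)
    also have "\<dots> = (\<Sum>b\<in>B. representation C (f b) c * representation B c b)"
      using C by (simp add: linear_sum[OF f] linear_scale[OF f] real_vector.representation_sum
          real_vector.representation_scale mult.commute)
    finally show "(\<Sum>b\<in>B. representation C (f b) c * representation B c b)
        = representation C (f c) c" ..
  qed
  finally show ?thesis .
qed

definition lie_bracket :: "('a::real_vector \<Rightarrow> 'a \<Rightarrow> 'a) \<Rightarrow> bool" where
  "lie_bracket br \<longleftrightarrow> bilinear br \<and> (\<forall>x. br x x = 0) \<and>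
    (\<forall>x y z. br x (br y z) + br y (br z x) + br z (br x y) = 0)"

definition unimodular :: "('a::real_vector \<Rightarrow> 'a \<Rightarrow> 'a) \<Rightarrow> bool" where
  "unimodular br \<longleftrightarrow> (\<forall>x. lin_trace (br x) = 0)"

definition bracket_span ::
    "('a::real_vector \<Rightarrow> 'a \<Rightarrow> 'a) \<Rightarrow> 'a set \<Rightarrow> 'a set \<Rightarrow> 'a set" where
  "bracket_span br A B = span {br a b | a b. a \<in> A \<and> b \<in> B}"

definition two_step_nilpotent :: "('a::real_vector \<Rightarrow> 'a \<Rightarrow> 'a) \<Rightarrow> bool" where
  "two_step_nilpotent br \<longleftrightarrow> bracket_span br (bracket_span br UNIV UNIV) UNIV = {0}"

definition complex_structure ::
    "('a::real_vector \<Rightarrow> 'a \<Rightarrow> 'a) \<Rightarrow> ('a \<Rightarrow> 'a) \<Rightarrow> bool" where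
  "complex_structure br J \<longleftrightarrow> linear J \<and> (\<forall>x. J (J x) = - x) \<and>
    (\<forall>x y. J (br x y) - br (J x) y - br x (J y) - J (br (J x) (J y)) = 0)"

definition abelian_complex_structure ::
    "('a::real_vector \<Rightarrow> 'a \<Rightarrow> 'a) \<Rightarrow> ('a \<Rightarrow> 'a) \<Rightarrow> bool" where
  "abelian_complex_structure br J \<longleftrightarrow>
    complex_structure br J \<and> (\<forall>x y. br (J x) (J y) = br x y)"

text \<open>A \<open>k\<close>-form is represented by a function on lists, of which only the values on lists of
  length \<open>k\<close> matter. The differential of a \<open>k\<close>-form \<open>\<alpha>\<close> is
  \[ d\alpha(x_0,\dots,x_k) = \sum_{i<j} (-1)^{i+j}
     \alpha([x_i,x_j],x_0,\dots,\hat x_i,\dots,\hat x_j,\dots,x_k). \]\<close>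

definition ce_d ::
    "('a \<Rightarrow> 'a \<Rightarrow> 'a) \<Rightarrow> ('a list \<Rightarrow> real) \<Rightarrow> 'a list \<Rightarrow> real" where
  "ce_d br \<alpha> xs = (\<Sum>j<length xs. \<Sum>i<j.
     (-1) ^ (i + j) * \<alpha> (br (xs ! i) (xs ! j) # nths xs (- {i, j})))"

definition form_J :: "('a \<Rightarrow> 'a) \<Rightarrow> ('a list \<Rightarrow> real) \<Rightarrow> 'a list \<Rightarrow> real" where
  "form_J J \<alpha> xs = \<alpha> (map J xs)"

lemma ce_d_1form: "ce_d br \<alpha> [x, y] = - \<alpha> [br x y]"
  by (simp add: ce_d_def numeral_eq_Suc nths_Cons)

lemma ce_d_2form:
  "ce_d br \<alpha> [x, y, z] = - \<alpha> [br x y, z] + \<alpha> [br x z, y] - \<alpha> [br y z, x]"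
  by (simp add: ce_d_def numeral_eq_Suc nths_Cons)

lemma ce_d_3form:
  "ce_d br \<alpha> [x, y, z, w] =
     - \<alpha> [br x y, z, w] + \<alpha> [br x z, y, w] - \<alpha> [br x w, y, z]
     - \<alpha> [br y z, x, w] + \<alpha> [br y w, x, z] - \<alpha> [br z w, x, y]"
  by (simp add: ce_d_def numeral_eq_Suc nths_Cons)

definition is_inner_product :: "('a::real_vector \<Rightarrow> 'a \<Rightarrow> real) \<Rightarrow> bool" where
  "is_inner_product g \<longleftrightarrow>
    bilinear g \<and> (\<forall>x y. g x y = g y x) \<and> (\<forall>x. x \<noteq> 0 \<longrightarrow> g x x > 0)"

definition hermitian_inner_product ::
    "('a::real_vector \<Rightarrow> 'a) \<Rightarrow> ('a \<Rightarrow> 'a \<Rightarrow> real) \<Rightarrow> bool" where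
  "hermitian_inner_product J g \<longleftrightarrow>
    is_inner_product g \<and> (\<forall>x y. g (J x) (J y) = g x y)"

definition fundamental_form ::
    "('a \<Rightarrow> 'a) \<Rightarrow> ('a \<Rightarrow> 'a \<Rightarrow> real) \<Rightarrow> 'a list \<Rightarrow> real" where
  "fundamental_form J g xs = g (J (xs ! 0)) (xs ! 1)"

definition pluriclosed_inner_product ::
    "('a::real_vector \<Rightarrow> 'a \<Rightarrow> 'a) \<Rightarrow> ('a \<Rightarrow> 'a) \<Rightarrow> ('a \<Rightarrow> 'a \<Rightarrow> real) \<Rightarrow> bool" where
  "pluriclosed_inner_product br J g \<longleftrightarrow> hermitian_inner_product J g \<and>
    (\<forall>x y z w. ce_d br (form_J J (ce_d br (fundamental_form J g))) [x, y, z, w] = 0)"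

end

theory Submission
  imports Defs
begin

text \<open>Write \<open>A\<close> for the derived algebra and \<open>u * v = [u, Jv]\<close>. As \<open>J\<close> is abelian, \<open>A\<close> is abelian and
  \<open>*\<close> is a commutative associative product on it, compatible with the adjoint action. Pluriclosedness
  says exactly that \<open>g([x,y],[z,w])\<close> satisfies the first Bianchi identity. It follows that
  \<open>[x, Jx] = 0\<close> forces \<open>x\<close> to be central, and that multiplication by \<open>u \<in> A\<close> is self-adjoint on
  \<open>A * A\<close>. Since \<open>ad (J(u * u))\<close> has image in \<open>A * A\<close>, where it is minus the square of this
  multiplication, unimodularity gives \<open>u * (A * A) = 0\<close>. Hence \<open>u * u\<close> is central, then so is every
  \<open>[v, u]\<close>, and finally \<open>[u, Ju] = 0\<close> for \<open>u = [x, y]\<close> by the Jacobi identity, so \<open>u\<close> is central.\<close>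

section \<open>Lie algebra identities and sums of two abelian parts\<close>

lemma lie_bracket_anti:
  assumes "lie_bracket br"
  shows "br x y = - br y x"
proof -
  have bil: "bilinear br" and alt: "br x x = 0" for x
    using assms by (auto simp: lie_bracket_def)
  have "br y x + br x y = 0"
    using alt[of "x + y", unfolded bilinear_ladd[OF bil] bilinear_radd[OF bil]] alt[of x] alt[of y]
    by simp
  then show ?thesis by (simp add: eq_neg_iff_add_eq_0 add.commute)
qed

lemma lie_bracket_leibniz:
  assumes "lie_bracket br"
  shows "br x (br y z) = br (br x y) z + br y (br x z)"
proof -
  have bil: "bilinear br" and jac: "br x (br y z) + br y (br z x) + br z (br x y) = 0"
    using assms by (auto simp: lie_bracket_def)
  have "br x (br y z) = - br y (br z x) - br z (br x y)"
    using jac by (simp add: algebra_simps eq_neg_iff_add_eq_0)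
  also have "\<dots> = br y (br x z) + br (br x y) z"
    using lie_bracket_anti[OF assms, of z x] lie_bracket_anti[OF assms, of z "br x y"]
    by (simp add: bilinear_rneg[OF bil])
  finally show ?thesis by (simp add: add.commute)
qed

text \<open>The Lie algebra case of Ito's theorem on products of two abelian groups.\<close>

lemma ito_metabelian:
  fixes br :: "'a::real_vector \<Rightarrow> 'a \<Rightarrow> 'a"
  assumes lie: "lie_bracket br"
    and P: "\<And>a b. a \<in> P \<Longrightarrow> b \<in> P \<Longrightarrow> br a b = 0"
    and Q: "\<And>a b. a \<in> Q \<Longrightarrow> b \<in> Q \<Longrightarrow> br a b = 0"
    and PQ: "\<And>x. \<exists>p\<in>P. \<exists>q\<in>Q. x = p + q"
  shows "br (br x y) (br z w) = 0"
proof -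
  have bil: "bilinear br"
    using lie by (simp add: lie_bracket_def)
  note bs = bilinear_ladd[OF bil] bilinear_radd[OF bil] bilinear_lneg[OF bil] bilinear_rneg[OF bil]
    bilinear_lzero[OF bil] bilinear_rzero[OF bil] bilinear_rsub[OF bil]
  note anti = lie_bracket_anti[OF lie] and leib = lie_bracket_leibniz[OF lie]
  have swap: "br (br a b) c = br (br a c) b" if "br b c = 0" for a b c
    using leib[of a b c] that anti[of b "br a c"] by (simp add: bs eq_neg_iff_add_eq_0)
  \<comment> \<open>With \<open>p1\<close> the \<open>P\<close>-part of \<open>[a, b']\<close> and
    \<open>q2\<close> the \<open>Q\<close>-part of \<open>[a', b]\<close>, the Leibniz expansion of
    \<open>[[a, b], [a', b']]\<close> consists of \<open>- [p1, q2]\<close> and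
    \<open>[p1, q2]\<close>.\<close>
  have key: "br (br a b) (br a' b') = 0"
    if a: "a \<in> P" "a' \<in> P" and b: "b \<in> Q" "b' \<in> Q" for a b a' b'
  proof -
    obtain p1 q1 where 1: "p1 \<in> P" "q1 \<in> Q" "br a b' = p1 + q1" using PQ by blast
    obtain p2 q2 where 2: "p2 \<in> P" "q2 \<in> Q" "br a' b = p2 + q2" using PQ by blast
    have "br (br a b) a' = br a (br b a')"
      using leib[of a b a'] a by (simp add: P bs)
    also have "\<dots> = - br a q2"
      using anti[of b a'] 2 a by (simp add: bs P)
    finally have 3: "br (br a b) a' = - br a q2" .
    have 4: "br (br a q2) b' = br p1 q2"
      using swap[of q2 b' a] 2 b 1 by (simp add: Q bs)
    have 5: "br (br a b) b' = br p1 b"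
      using swap[of b b' a] b 1 by (simp add: Q bs)
    have 6: "br a' (br p1 b) = br p1 q2"
      using leib[of a' p1 b] a 1 2 by (simp add: P bs)
    show ?thesis
      using leib[of "br a b" a' b'] by (simp add: 3 4 5 6 bs)
  qed
  have decomp: "\<exists>a b a' b'. a \<in> P \<and> b \<in> Q \<and> a' \<in> P \<and> b' \<in> Q \<and> br x y = br a b + br a' b'" for x y
  proof -
    obtain p q where 1: "p \<in> P" "q \<in> Q" "x = p + q" using PQ by blast
    obtain p' q' where 2: "p' \<in> P" "q' \<in> Q" "y = p' + q'" using PQ by blast
    \<comment> \<open>\<open>P\<close> is a mere set, so \<open>- p'\<close> need not lie in it; it
      is split once more, and its \<open>Q\<close>-part commutes with \<open>q\<close>.\<close>
    have m: "br (- p') q = br q p'"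
      using anti[of q p'] by (simp add: bs)
    obtain r s where 3: "r \<in> P" "s \<in> Q" "- p' = r + s" using PQ by blast
    have "br x y = br p q' + br r q"
      using 1 2 3 m by (simp add: bs P Q)
    then show ?thesis using 1 2 3 by blast
  qed
  obtain a b a' b' where 1: "a \<in> P" "b \<in> Q" "a' \<in> P" "b' \<in> Q" "br x y = br a b + br a' b'"
    using decomp by metis
  obtain c d c' d' where 2: "c \<in> P" "d \<in> Q" "c' \<in> P" "d' \<in> Q" "br z w = br c d + br c' d'"
    using decomp by metis
  show ?thesis using 1 2 by (simp add: bs key)
qed

section \<open>Abelian complex structures and the product on the derived algebra\<close>

locale abelian_J =
  fixes br :: "'a::real_vector \<Rightarrow> 'a \<Rightarrow> 'a" and J :: "'a \<Rightarrow> 'a"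
  assumes lie: "lie_bracket br" and J: "abelian_complex_structure br J"
begin

lemma bil: "bilinear br" and br_self: "br x x = 0"
  and jacobi: "br x (br y z) + br y (br z x) + br z (br x y) = 0"
  and linear_J: "linear J" and J_J: "J (J x) = - x" and br_J_J: "br (J x) (J y) = br x y"
  using lie J by (auto simp: lie_bracket_def abelian_complex_structure_def complex_structure_def)

lemmas br_simps = bilinear_ladd[OF bil] bilinear_radd[OF bil] bilinear_lneg[OF bil]
  bilinear_rneg[OF bil] bilinear_lzero[OF bil] bilinear_rzero[OF bil]
  bilinear_lsub[OF bil] bilinear_rsub[OF bil] bilinear_lmul[OF bil] bilinear_rmul[OF bil]

lemmas J_simps = linear_add[OF linear_J] linear_neg[OF linear_J] linear_0[OF linear_J]
  linear_diff[OF linear_J] linear_scale[OF linear_J] J_J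

lemmas br_anti = lie_bracket_anti[OF lie] and leibniz = lie_bracket_leibniz[OF lie]

lemma br_J_left: "br (J x) y = - br x (J y)"
  using br_J_J[of x "J y"] by (simp add: J_simps br_simps minus_equation_iff eq_commute)

text \<open>This is commutativity of \<open>*\<close>, valid for arbitrary vectors.\<close>

lemma br_J_commute: "br x (J y) = br y (J x)"
  using br_J_left[of x y] br_anti[of "J x" y] by simp

text \<open>The complexified Lie algebra, realised on pairs \<open>x + iy\<close>, is the sum of the eigenspaces
  \<open>x \<mp> iJx\<close> of \<open>J\<close>, which are abelian subalgebras because \<open>J\<close> is abelian.\<close>

lemma derived_abelian: "br (br x y) (br z w) = 0"
proof -
  define cbr where "cbr = (\<lambda>(x, x') (y, y'). (br x y - br x' y', br x y' + br x' y))"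
  define P where "P = range (\<lambda>x. (x, - J x))"
  define Q where "Q = range (\<lambda>x. (x, J x))"
  have "bilinear cbr"
    unfolding bilinear_def cbr_def
    by (auto intro!: linearI simp: br_simps scaleR_add_right scaleR_diff_right)
  moreover have "cbr p p = 0" for p
    using br_anti[of "fst p" "snd p"] by (cases p) (simp add: cbr_def br_self zero_prod_def)
  moreover have "cbr p (cbr q r) + cbr q (cbr r p) + cbr r (cbr p q) = 0" for p q r
  proof -
    obtain x x' y y' z z' where [simp]: "p = (x, x')" "q = (y, y')" "r = (z, z')"
      by (metis surj_pair)
    define j where "j a b c = br a (br b c) + br b (br c a) + br c (br a b)" for a b c
    have "cbr p (cbr q r) + cbr q (cbr r p) + cbr r (cbr p q)
        = (j x y z - j x' y' z - j x' y z' - j x y' z', j x' y z + j x y' z + j x y z' - j x' y' z')"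
      by (simp add: cbr_def j_def br_simps)
    then show ?thesis by (simp add: j_def jacobi zero_prod_def)
  qed
  ultimately have "lie_bracket cbr"
    by (simp add: lie_bracket_def)
  moreover have "\<exists>p\<in>P. \<exists>q\<in>Q. v = p + q" for v
  proof -
    obtain x y where v: "v = (x, y)" by (cases v)
    \<comment> \<open>The two first components \<open>a\<close>, \<open>b\<close> solve
      \<open>a + b = x\<close> and \<open>- J a + J b = y\<close>.\<close>
    have "v = ((1/2) *\<^sub>R (x + J y), - J ((1/2) *\<^sub>R (x + J y)))
        + ((1/2) *\<^sub>R (x - J y), J ((1/2) *\<^sub>R (x - J y)))"
      by (simp add: v J_simps algebra_simps flip: scaleR_add_left)
    then show ?thesis unfolding P_def Q_def by blast
  qed
  moreover have "cbr a b = 0" if "a \<in> P" "b \<in> P" for a b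
    using that by (auto simp: P_def cbr_def zero_prod_def br_simps br_J_left J_J)
  moreover have "cbr a b = 0" if "a \<in> Q" "b \<in> Q" for a b
    using that by (auto simp: Q_def cbr_def zero_prod_def br_simps br_J_left J_J)
  ultimately have "cbr (cbr (x, 0) (y, 0)) (cbr (z, 0) (w, 0)) = 0"
    using ito_metabelian[of cbr P Q] by metis
  then show ?thesis by (simp add: cbr_def br_simps zero_prod_def)
qed

text \<open>The other Leibniz term is a bracket of two commutators and vanishes by
  \<open>derived_abelian\<close>.\<close>

lemma br_act_mult: "br x (br (br a b) (J q)) = br (br x (br a b)) (J q)"
  by (subst leibniz) (simp add: derived_abelian)

text \<open>Multiplication by \<open>u\<close> is minus the adjoint action of \<open>J u\<close>, so
  associativity is a case of \<open>br_act_mult\<close>.\<close>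

lemma br_mult_assoc: "br u (J (br (br a b) (J q))) = br (br u (J (br a b))) (J q)"
proof -
  have "br u (J (br (br a b) (J q))) = - br (J u) (br (br a b) (J q))"
    by (simp add: br_J_left)
  also have "\<dots> = br (br u (J (br a b))) (J q)"
    by (simp add: br_act_mult br_J_left br_simps)
  finally show ?thesis .
qed

end

section \<open>Orthonormal bases and traces\<close>

definition orthonormal_set :: "('a::real_vector \<Rightarrow> 'a \<Rightarrow> real) \<Rightarrow> 'a set \<Rightarrow> bool" where
  "orthonormal_set g B \<longleftrightarrow> (\<forall>x\<in>B. \<forall>y\<in>B. g x y = (if x = y then 1 else 0))"

lemma bilinear_sum_scale_left:
  fixes g :: "'a::real_vector \<Rightarrow> 'a \<Rightarrow> real"
  assumes "bilinear g"
  shows "g (\<Sum>b\<in>B. c b *\<^sub>R b) v = (\<Sum>b\<in>B. c b * g b v)"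
proof -
  have "linear (\<lambda>x. g x v)" using assms by (simp add: bilinear_def)
  from linear_sum[OF this, of "\<lambda>b. c b *\<^sub>R b" B] show ?thesis
    by (simp add: bilinear_lmul[OF assms])
qed

lemma orthonormal_representation:
  assumes g: "is_inner_product g" and B: "orthonormal_set g B" "finite B" and v: "v \<in> span B"
  shows "v = (\<Sum>b\<in>B. g v b *\<^sub>R b)"
proof -
  have bil: "bilinear g" using g by (simp add: is_inner_product_def)
  obtain c where c: "v = (\<Sum>b\<in>B. c b *\<^sub>R b)"
    using v span_finite[OF B(2)] by auto
  have "g v b = c b" if "b \<in> B" for b
  proof -
    have "g v b = (\<Sum>b'\<in>B. c b' * g b' b)"
      unfolding c by (rule bilinear_sum_scale_left[OF bil])
    also have "\<dots> = (\<Sum>b'\<in>B. if b' = b then c b' else 0)"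
      using B(1) that by (intro sum.cong) (auto simp: orthonormal_set_def)
    finally show ?thesis using B(2) that by simp
  qed
  then show ?thesis using c by simp
qed

lemma orthonormal_independent:
  assumes g: "is_inner_product g" and B: "orthonormal_set g B" "finite B"
  shows "independent B"
proof -
  have bil: "bilinear g" using g by (simp add: is_inner_product_def)
  show ?thesis
  proof (rule independent_if_scalars_zero[OF B(2)])
    fix c b assume z: "(\<Sum>x\<in>B. c x *\<^sub>R x) = 0" and b: "b \<in> B"
    have "0 = g (\<Sum>x\<in>B. c x *\<^sub>R x) b"
      by (simp add: z bilinear_lzero[OF bil])
    also have "\<dots> = (\<Sum>b'\<in>B. c b' * g b' b)"
      by (rule bilinear_sum_scale_left[OF bil])
    also have "\<dots> = (\<Sum>b'\<in>B. if b' = b then c b' else 0)"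
      using B(1) b by (intro sum.cong) (auto simp: orthonormal_set_def)
    finally show "c b = 0" using B(2) b by simp
  qed
qed

text \<open>Orthonormal sets are independent, hence bounded in size, so a largest one between
  \<open>C\<close> and \<open>S\<close> exists. It spans \<open>S\<close>: a nonzero residual
  \<open>r\<close> of some \<open>v\<close> in \<open>S\<close>, once normalised, would enlarge
  it.\<close>

lemma orthonormal_extend:
  fixes g :: "'a::real_vector \<Rightarrow> 'a \<Rightarrow> real"
  assumes fd: "finite_dim TYPE('a)" and g: "is_inner_product g"
    and C: "orthonormal_set g C" "finite C" "C \<subseteq> S" and S: "subspace S"
  obtains B where "orthonormal_set g B" "finite B" "C \<subseteq> B" "span B = S"
proof -
  have bil: "bilinear g" and sym: "\<And>x y. g x y = g y x" and pos: "\<And>x. x \<noteq> 0 \<Longrightarrow> g x x > 0"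
    using g by (auto simp: is_inner_product_def)
  obtain D :: "'a set" where D: "finite D" "span D = UNIV"
    using fd unfolding finite_dim_def by blast
  define ok where "ok B \<longleftrightarrow> orthonormal_set g B \<and> finite B \<and> C \<subseteq> B \<and> B \<subseteq> S" for B
  have "card B < Suc (card D)" if "ok B" for B
    using real_vector.independent_span_bound[of D B] D orthonormal_independent[OF g, of B] that
    by (auto simp: ok_def)
  moreover have "ok C" using C by (simp add: ok_def)
  ultimately obtain B where B: "ok B" and max: "\<And>B'. ok B' \<Longrightarrow> card B' \<le> card B"
    using ex_has_greatest_nat[of ok C card "Suc (card D)"] by (metis less_imp_le)
  have "S \<subseteq> span B"
  proof
    fix v assume v: "v \<in> S"
    define r where "r = v - (\<Sum>b\<in>B. g v b *\<^sub>R b)"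
    have rS: "r \<in> S"
      unfolding r_def using v B S by (intro subspace_diff subspace_sum subspace_scale) (auto simp: ok_def)
    have orth: "g r b = 0" if "b \<in> B" for b
    proof -
      have "g r b = g v b - (\<Sum>b'\<in>B. g v b' * g b' b)"
        by (simp add: r_def bilinear_lsub[OF bil] bilinear_sum_scale_left[OF bil])
      also have "(\<Sum>b'\<in>B. g v b' * g b' b) = (\<Sum>b'\<in>B. if b' = b then g v b' else 0)"
        using B that by (intro sum.cong) (auto simp: orthonormal_set_def ok_def)
      finally show ?thesis using B that by (simp add: ok_def)
    qed
    have "r = 0"
    proof (rule ccontr)
      assume "r \<noteq> 0"
      then have p: "g r r > 0" by (rule pos)
      define e where "e = (1 / sqrt (g r r)) *\<^sub>R r"
      have ee: "g e e = 1"
        using p by (simp add: e_def bilinear_lmul[OF bil] bilinear_rmul[OF bil] field_simps)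
      have eb: "g e b = 0" "g b e = 0" if "b \<in> B" for b
        using orth[OF that] sym[of b e] by (simp_all add: e_def bilinear_lmul[OF bil])
      have "e \<notin> B" using ee eb by force
      moreover have "ok (insert e B)"
        using B rS S ee eb \<open>e \<notin> B\<close>
        by (auto simp: ok_def orthonormal_set_def e_def intro: subspace_scale)
      ultimately show False using max[of "insert e B"] B by (auto simp: ok_def)
    qed
    then have "v = (\<Sum>b\<in>B. g v b *\<^sub>R b)" by (simp add: r_def)
    also have "\<dots> \<in> span B" by (intro span_sum span_scale span_base)
    finally show "v \<in> span B" .
  qed
  moreover have "span B \<subseteq> S" using B S by (simp add: ok_def span_minimal)
  ultimately show ?thesis using that[of B] B by (auto simp: ok_def)
qed

lemma lin_trace_orthonormal:
  fixes g :: "'a::real_vector \<Rightarrow> 'a \<Rightarrow> real"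
  assumes fd: "finite_dim TYPE('a)" and g: "is_inner_product g" and f: "linear f"
    and B: "orthonormal_set g B" "finite B" "span B = UNIV"
  shows "lin_trace f = (\<Sum>b\<in>B. g (f b) b)"
proof -
  have ind: "independent B" using orthonormal_independent[OF g B(1,2)] .
  have "representation B v b = g v b" if b: "b \<in> B" for v b
  proof -
    have "representation B v b = representation B (\<Sum>c\<in>B. g v c *\<^sub>R c) b"
      using orthonormal_representation[OF g B(1,2), of v] B(3) by simp
    also have "\<dots> = (\<Sum>c\<in>B. g v c * representation B c b)"
      using ind B by (simp add: real_vector.representation_sum real_vector.representation_scale)
    also have "\<dots> = (\<Sum>c\<in>B. if c = b then g v c else 0)"
      using ind by (intro sum.cong) (auto simp: real_vector.representation_basis)
    finally show ?thesis using B b by simp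
  qed
  then show ?thesis
    using lin_trace_eq[OF fd f ind B(3)] by simp
qed

section \<open>Pluriclosed inner products and the Bianchi identity\<close>

locale pluriclosed_abelian_J = abelian_J br J
  for br :: "'a::real_vector \<Rightarrow> 'a \<Rightarrow> 'a" and J +
  fixes g :: "'a \<Rightarrow> 'a \<Rightarrow> real"
  assumes fd: "finite_dim TYPE('a)" and unimod: "unimodular br"
    and pluri: "pluriclosed_inner_product br J g"
begin

lemma ip: "is_inner_product g" and gbil: "bilinear g" and gsym: "g x y = g y x"
  and gpos: "x \<noteq> 0 \<Longrightarrow> g x x > 0" and gJ: "g (J x) (J y) = g x y"
  using pluri by (auto simp: pluriclosed_inner_product_def hermitian_inner_product_def
      is_inner_product_def)

lemmas g_simps = bilinear_ladd[OF gbil] bilinear_radd[OF gbil] bilinear_lneg[OF gbil]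
  bilinear_rneg[OF gbil] bilinear_lzero[OF gbil] bilinear_rzero[OF gbil]
  bilinear_lsub[OF gbil] bilinear_rsub[OF gbil] bilinear_lmul[OF gbil] bilinear_rmul[OF gbil]

lemma gnn: "g x x \<ge> 0" and g_eq_0: "g x x = 0 \<Longrightarrow> x = 0"
  using gpos[of x] by (cases "x = 0"; force simp: g_simps)+

text \<open>Since \<open>J\<close> is abelian and \<open>g\<close> is \<open>J\<close>-invariant,
  every \<open>J\<close> drops out. Up to sign this 3-form is the torsion of the Bismut
  connection.\<close>

lemma torsion:
  "form_J J (ce_d br (fundamental_form J g)) [x, y, z] = - g (br x y) z + g (br x z) y - g (br y z) x"
  by (simp add: form_J_def ce_d_2form fundamental_form_def br_J_J gJ)

text \<open>The terms of the form \<open>g([[x,y],z],w)\<close> in \<open>dJd\<omega>\<close> cancel by the Jacobi identity.\<close>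

lemma bianchi: "g (br x y) (br z w) + g (br y z) (br x w) + g (br z x) (br y w) = 0"
proof -
  have jac: "g (br (br a b) c) d + g (br (br b c) a) d + g (br (br c a) b) d = 0" for a b c d
  proof -
    have "br (br a b) c + br (br b c) a + br (br c a) b = 0"
      using jacobi[of c a b] br_anti[of "br a b" c] br_anti[of "br b c" a] br_anti[of "br c a" b]
      by (simp add: algebra_simps neg_eq_iff_add_eq_0)
    then show ?thesis by (metis g_simps(1,5))
  qed
  have anti: "g (br (br a b) c) d = - g (br (br b a) c) d" for a b c d
    using br_anti[of a b] by (simp add: br_simps g_simps)
  have anti2: "g (br a b) c = - g (br b a) c" for a b c
    using br_anti[of a b] by (simp add: g_simps)
  have "ce_d br (form_J J (ce_d br (fundamental_form J g))) [x, y, z, w] = 0"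
    using pluri by (simp add: pluriclosed_inner_product_def)
  note E = this[unfolded ce_d_3form torsion]
  show ?thesis
    using E jac[of x y z w] jac[of x y w z] jac[of x z w y] jac[of y z w x]
      anti[of z x y w] anti[of w x y z] anti[of w x z y] anti[of w y z x]
      anti2[of z x "br y w"]
      gsym[of "br z w" "br x y"] gsym[of "br y w" "br x z"] gsym[of "br x w" "br y z"]
    by linarith
qed

text \<open>In the Bianchi identity for \<open>x\<close>, \<open>J x\<close>, \<open>y\<close>,
  \<open>J y\<close> the other two terms are minus squared norms.\<close>

lemma br_J_inner: "g (br x (J x)) (br y (J y)) = g (br x y) (br x y) + g (br x (J y)) (br x (J y))"
proof -
  have "g (br x (J x)) (br y (J y)) + g (br (J x) y) (br x (J y)) + g (br y x) (br (J x) (J y)) = 0"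
    by (rule bianchi)
  then show ?thesis
    using br_anti[of y x] by (simp add: br_J_left J_simps br_simps g_simps)
qed

text \<open>The left side of \<open>br_J_inner\<close> vanishes, hence so does each square on the
  right.\<close>

lemma central_if: "br x (J x) = 0 \<Longrightarrow> br x y = 0"
  using br_J_inner[of x y] gnn[of "br x y"] gnn[of "br x (J y)"] g_eq_0[of "br x y"]
  by (simp add: g_simps)

text \<open>The Bianchi identity for \<open>u\<close>, \<open>J v\<close>, \<open>c\<close>,
  \<open>J b\<close> loses one term by the assumption; what remains reads
  \<open>g(u * v, c * b) = g(v * c, u * b)\<close>.\<close>

lemma mult_inner_swap:
  assumes "br c u = 0"
  shows "g (br u (J v)) (br c (J b)) = g (br v (J c)) (br u (J b))"
  using bianchi[of u "J v" c "J b"] assms by (simp add: br_J_J br_J_left g_simps)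

section \<open>The space \<open>A * A\<close> and multiplication by a commutator on it\<close>

definition mult_span :: "'a set" where
  "mult_span = span {br (br a b) (J (br c d)) | a b c d. True}"

text \<open>Three swaps by \<open>mult_inner_swap\<close>, with reassociation in between, carry
  \<open>u\<close> across: \<open>g((u * p) * q, c * b) = g(q * c, (u * p) * b) = g((u * p) * c, b *
  q) = g(p * (c * u), b * q) = g((c * u) * b, p * q)\<close>.\<close>

lemma mult_selfadjoint_gen:
  assumes "u = br u1 u2" "p = br p1 p2" "q = br q1 q2" "c = br c1 c2" "b = br b1 b2"
  shows "g (br u (J (br p (J q)))) (br c (J b)) = g (br p (J q)) (br u (J (br c (J b))))"
proof -
  have "g (br u (J (br p (J q)))) (br c (J b)) = g (br (br u (J p)) (J q)) (br c (J b))"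
    using assms by (simp add: br_mult_assoc)
  also have "\<dots> = g (br q (J c)) (br (br u (J p)) (J b))"
    by (rule mult_inner_swap) (simp add: assms derived_abelian)
  also have "\<dots> = g (br (br u (J p)) (J c)) (br b (J q))"
    using mult_inner_swap[of "br u (J p)" q c b] br_J_commute[of c "br u (J p)"] br_J_commute[of q b]
    by (simp add: assms derived_abelian)
  also have "br (br u (J p)) (J c) = br p (J (br c (J u)))"
    using assms by (metis br_J_commute br_mult_assoc)
  also have "g (br p (J (br c (J u)))) (br b (J q)) = g (br (br c (J u)) (J b)) (br p (J q))"
    by (rule mult_inner_swap) (simp add: assms derived_abelian)
  also have "br (br c (J u)) (J b) = br u (J (br c (J b)))"
    using assms by (metis br_J_commute br_mult_assoc)
  finally show ?thesis by (simp add: gsym)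
qed

lemma mult_selfadjoint:
  assumes u: "u = br u1 u2" and "s \<in> mult_span" "t \<in> mult_span"
  shows "g (br u (J s)) t = g s (br u (J t))"
  using assms(2) unfolding mult_span_def
proof (induction rule: span_induct_alt)
  case base
  then show ?case by (simp add: br_simps g_simps J_simps)
next
  case (step c x y)
  have "g (br u (J x)) t = g x (br u (J t))"
    using assms(3) unfolding mult_span_def
  proof (induction rule: span_induct_alt)
    case base
    then show ?case by (simp add: br_simps g_simps J_simps)
  next
    case (step c x' y')
    then show ?case
      using \<open>x \<in> _\<close> mult_selfadjoint_gen[OF u] by (auto simp: br_simps g_simps J_simps)
  qed
  then show ?case using step by (simp add: br_simps g_simps J_simps)
qed

text \<open>In an orthonormal basis adapted to \<open>A * A\<close>, the trace of
  \<open>ad (J(u * u))\<close> is minus the sum of the squared norms of \<open>u * b\<close> over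
  the basis vectors \<open>b\<close> of \<open>A * A\<close>. Unimodularity makes it zero.\<close>

lemma mult_mult_span:
  assumes "s \<in> mult_span" "u = br u1 u2"
  shows "br u (J s) = 0"
proof -
  let ?S = mult_span
  have subS: "subspace ?S" by (simp add: mult_span_def)
  obtain C where C: "orthonormal_set g C" "finite C" "span C = ?S"
    using orthonormal_extend[OF fd ip _ _ _ subS, of "{}"] by (auto simp: orthonormal_set_def)
  obtain B where B: "orthonormal_set g B" "finite B" "C \<subseteq> B" "span B = UNIV"
    using orthonormal_extend[OF fd ip C(1,2) _ subspace_UNIV] by auto
  define w where "w = br u (J u)"
  \<comment> \<open>\<open>[J w, y] = [J y, u * u] = [J y, u] * u\<close>, a product of two
    commutators.\<close>
  have w: "br (J w) y \<in> ?S" for y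
  proof -
    have "br (J w) y = - br w (J y)" by (rule br_J_left)
    also have "\<dots> = br (J y) w" by (metis br_anti)
    also have "\<dots> = br (br (J y) u) (J u)" by (simp add: w_def assms(2) br_act_mult)
    also have "\<dots> \<in> ?S" unfolding mult_span_def assms(2) by (rule span_base) blast
    finally show ?thesis .
  qed
  \<comment> \<open>\<open>[J w, b] = - u * (u * b)\<close>, and one factor \<open>u\<close> moves
    to the other side by self-adjointness, which requires \<open>u * b\<close> to lie in
    \<open>A * A\<close> as well.\<close>
  have inC: "g (br (J w) b) b = - g (br u (J b)) (br u (J b))" if "b \<in> C" for b
  proof -
    have bS: "b \<in> ?S" using C(3) that span_base by blast
    have uS: "br u (J s) \<in> ?S" if "s \<in> ?S" for s
      using that unfolding mult_span_def
    proof (induction rule: span_induct_alt)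
      case base
      then show ?case by (simp add: br_simps J_simps span_zero)
    next
      case (step c x y)
      from \<open>x \<in> _\<close> have "br u (J x) \<in> {br (br a b) (J (br c d)) | a b c d. True}"
        using assms(2) by (auto simp: br_mult_assoc)
      with step show ?case by (simp add: br_simps J_simps span_add span_scale span_base)
    qed
    have "br (J w) b = - br b (J w)" using br_anti by blast
    also have "br b (J w) = br u (J (br u (J b)))"
      using br_mult_assoc[of b u1 u2 u] br_J_commute assms(2) by (metis w_def)
    finally show ?thesis
      using mult_selfadjoint[OF assms(2) uS[OF bS] bS] by (simp add: g_simps)
  qed
  have out: "g (br (J w) b) b = 0" if "b \<in> B - C" for b
  proof -
    have "br (J w) b \<in> span C" using w C(3) by simp
    then obtain k where "br (J w) b = (\<Sum>c\<in>C. k c *\<^sub>R c)"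
      using span_finite[OF C(2)] by auto
    moreover have "g c b = 0" if "c \<in> C" for c
      using B(1,3) that \<open>b \<in> B - C\<close> by (auto simp: orthonormal_set_def)
    ultimately show ?thesis
      by (simp add: bilinear_sum_scale_left[OF gbil])
  qed
  have "0 = lin_trace (br (J w))" using unimod by (simp add: unimodular_def)
  also have "\<dots> = (\<Sum>b\<in>B. g (br (J w) b) b)"
    using bil by (intro lin_trace_orthonormal[OF fd ip _ B(1,2,4)]) (simp add: bilinear_def)
  also have "\<dots> = (\<Sum>b\<in>C. g (br (J w) b) b)"
    by (rule sum.mono_neutral_right[OF B(2,3)]) (use out in blast)
  also have "\<dots> = - (\<Sum>b\<in>C. g (br u (J b)) (br u (J b)))"
    by (simp add: inC sum_negf)
  finally have "(\<Sum>b\<in>C. g (br u (J b)) (br u (J b))) = 0" by simp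
  then have uC: "br u (J b) = 0" if "b \<in> C" for b
    using that C(2) gnn g_eq_0 by (simp add: sum_nonneg_eq_0_iff)
  have "br u (J s) = 0" if "s \<in> span C" for s
    using that by (induction rule: span_induct_alt) (simp_all add: br_simps J_simps uC)
  then show ?thesis using assms C(3) by simp
qed

section \<open>Centrality of commutators\<close>

lemma br_br_central: "br (br x y) z = 0"
proof -
  define u where "u = br x y"
  define w where "w = br u (J u)"
  have w: "w \<in> mult_span" unfolding w_def u_def mult_span_def by (rule span_base) blast
  \<comment> \<open>\<open>w * w = u * (u * w)\<close> by associativity, and \<open>u * w\<close>
    vanishes because \<open>w\<close> lies in \<open>A * A\<close>.\<close>
  have "br w (J w) = br u (J (br u (J w)))"
    using br_mult_assoc[of w x y u] br_J_commute by (metis u_def w_def)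
  then have "br w (J w) = 0"
    by (simp add: mult_mult_span[OF w u_def] J_simps br_simps)
  then have wc: "br w v = 0" for v by (rule central_if)
  \<comment> \<open>With \<open>b = [v, u]\<close>, the action on products gives
    \<open>u * b = [v, u * u] = 0\<close> by centrality of \<open>w\<close>, and then
    \<open>b * b = [v, u * b] = 0\<close>.\<close>
  have bc: "br (br v u) v' = 0" for v v'
  proof (rule central_if)
    let ?b = "br v u"
    have "br u (J ?b) = br ?b (J u)" by (rule br_J_commute)
    also have "\<dots> = br v w" by (simp add: u_def w_def br_act_mult)
    also have "\<dots> = 0" using wc br_anti[of v w] by simp
    finally have "br u (J ?b) = 0" .
    then show "br ?b (J ?b) = 0"
      using br_act_mult[of v x y ?b] by (simp add: u_def br_simps)
  qed
  \<comment> \<open>Moving \<open>J\<close> turns \<open>[v', J u]\<close> into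
    \<open>- [J v', u]\<close>, which is central by \<open>bc\<close>.\<close>
  have c: "br v (br v' (J u)) = 0" for v v'
  proof -
    have "br v' (J u) = - br (J v') u" by (simp add: br_J_left)
    then show ?thesis using br_anti[of v "br (J v') u"] bc by (simp add: br_simps)
  qed
  \<comment> \<open>Both double brackets in the Leibniz rule for \<open>[x, [y, J u]]\<close> vanish
    by \<open>c\<close>, leaving \<open>[[x, y], J u] = 0\<close>.\<close>
  have "br u (J u) = 0"
    using leibniz[of x y "J u"] c by (simp add: u_def)
  then show ?thesis unfolding u_def by (rule central_if)
qed

end

theorem theorem1p1:
  fixes br :: "'a::real_vector \<Rightarrow> 'a \<Rightarrow> 'a"
    and J :: "'a \<Rightarrow> 'a"
  assumes "finite_dim TYPE('a)"
    and "lie_bracket br"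
    and "unimodular br"
    and "abelian_complex_structure br J"
    and "\<exists>g. pluriclosed_inner_product br J g"
  shows "two_step_nilpotent br"
proof -
  obtain g where "pluriclosed_inner_product br J g" using assms(5) by blast
  then interpret pluriclosed_abelian_J br J g
    using assms by unfold_locales
  have "br v z = 0" if "v \<in> span {br a b | a b. a \<in> UNIV \<and> b \<in> UNIV}" for v z
    using that by (induction rule: span_induct_alt) (auto simp: br_simps br_br_central)
  then have "{br v z | v z. v \<in> bracket_span br UNIV UNIV \<and> z \<in> UNIV} = {0}"
    by (auto simp: bracket_span_def br_simps intro!: exI[of _ 0] span_zero)
  then show ?thesis
    by (simp add: two_step_nilpotent_def bracket_span_def[of br "bracket_span br UNIV UNIV"])
qed

end
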